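(* Let $\mathcal{H}=\{G_1,\dots,G_k\}$ be a family of pairwise disjoint non-trivial connected graphs and let $G[\mathcal{H}]$ be a graph obtained by point-attaching from $\mathcal{H}$. Suppose $G[\mathcal{H}]$ is not bipartite. Then $$\dim_l(G[\mathcal{H}])\le \sum_{j\in J_{\mathcal{H}}}\bigl(\dim_l(G_j)-\alpha_j\bigr).$$
   Context: All graphs are finite, simple. For a connected graph $G$, $d_G(x,y)$ is the length of a shortest $x$–$y$ path. A set $W\subseteq V(G)$ is a local metric generator for $G$ if for every pair of adjacent vertices $u,v$ there is $w\in W$ with $d_G(u,w)\neq d_G(v,w)$. The local metric dimension $\dim_l(G)$ is the minimum cardinality of a local metric generator; a local metric generator of that cardinality is a local metric basis. Point-attaching: starting from $G_1$, for $i=1,\dots,k-1$, select a vertex of the already constructed graph and a vertex of $G_{i+1}$ and identify them; the result $G[\mathcal{H}]$ is said to be obtained by point-attaching from $G_1,\dots,G_k$, and the $G_i$ (viewed as subgraphs of $G[\mathcal{H}]$) are its primary subgraphs. Attachment vertices are the vertices of $G[\mathcal{H}]$ obtained by identifying vertices of different primary subgraphs. For an attachment vertex $x$ and a primary subgraph $G_j$ with $x\in V(G_j)$, $G_j(x^+)$ is the connected component containing $x$ of the graph obtained from $G[\mathcal{H}]$ by removing all edges joining $x$ to vertices of $G_j$. $J_{\mathcal{H}}\subseteq\{1,\dots,k\}$ is the set of indices $j$ such that $G_j$ is not bipartite. For $j\in J_{\mathcal{H}}$, $C_j$ is the set of attachment vertices $x\in V(G_j)$ such that $G_j(x^+)$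 is not bipartite, and $\alpha_j=\max\{|C_j\cap B| : B \text{ a local metric basis of } G_j\}$. *)

theory Defs
  imports "Graph_Theory.Graph_Theory"
begin

(* Finite simple graphs are the library's pair_graph: finite, loop-free digraphs with a
   symmetric set of arcs, every edge being represented by its two orientations. *)

section \<open>Local metric dimension\<close>

definition bipartite :: "('a, 'b) pre_digraph \<Rightarrow> bool" where
  "bipartite G \<longleftrightarrow> (\<exists>X Y. X \<union> Y = verts G \<and> X \<inter> Y = {} \<and>
     (\<forall>u v. u \<rightarrow>\<^bsub>G\<^esub> v \<longrightarrow> u \<in> X \<and> v \<in> Y \<or> u \<in> Y \<and> v \<in> X))"

definition graph_dist :: "('a, 'b) pre_digraph \<Rightarrow> 'a \<Rightarrow> 'a \<Rightarrow> nat" where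
  "graph_dist G x y = (LEAST n. \<exists>p. pre_digraph.apath G x p y \<and> length p = n)"

definition local_metric_generator :: "('a, 'b) pre_digraph \<Rightarrow> 'a set \<Rightarrow> bool" where
  "local_metric_generator G W \<longleftrightarrow> W \<subseteq> verts G \<and>
     (\<forall>u v. u \<rightarrow>\<^bsub>G\<^esub> v \<longrightarrow> (\<exists>w\<in>W. graph_dist G u w \<noteq> graph_dist G v w))"

definition local_metric_dim :: "('a, 'b) pre_digraph \<Rightarrow> nat" where
  "local_metric_dim G = (LEAST n. \<exists>W. local_metric_generator G W \<and> card W = n)"

definition local_metric_basis :: "('a, 'b) pre_digraph \<Rightarrow> 'a set \<Rightarrow> bool" where
  "local_metric_basis G B \<longleftrightarrow> local_metric_generator G B \<and> card B = local_metric_dim G"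

section \<open>Point-attaching\<close>

(* A family is H 0, ..., H (k - 1).  In step i (Suc i < k) the vertex a i of the graph built so
   far is identified with the vertex b i of H (Suc i); the identified vertex is called a i.
   As the members of the family are pairwise disjoint, this is realised by renaming b i to a i
   in H (Suc i) and taking the union. *)

definition rename_vertex :: "'a \<Rightarrow> 'a \<Rightarrow> 'a pair_pre_digraph \<Rightarrow> 'a pair_pre_digraph" where
  "rename_vertex y x G =
     \<lparr>pverts = (id(y := x)) ` pverts G,
      parcs = map_prod (id(y := x)) (id(y := x)) ` parcs G\<rparr>"

(* H j viewed as a subgraph of the graph obtained by point-attaching *)
fun primary_subgraph ::
  "(nat \<Rightarrow> 'a pair_pre_digraph) \<Rightarrow> (nat \<Rightarrow> 'a) \<Rightarrow> (nat \<Rightarrow> 'a) \<Rightarrow> nat \<Rightarrow> 'a pair_pre_digraph"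
where
  "primary_subgraph H a b 0 = H 0"
| "primary_subgraph H a b (Suc i) = rename_vertex (b i) (a i) (H (Suc i))"

(* the graph after n attaching steps, built from H 0, ..., H n *)
fun point_attach ::
  "(nat \<Rightarrow> 'a pair_pre_digraph) \<Rightarrow> (nat \<Rightarrow> 'a) \<Rightarrow> (nat \<Rightarrow> 'a) \<Rightarrow> nat \<Rightarrow> 'a pair_pre_digraph"
where
  "point_attach H a b 0 = H 0"
| "point_attach H a b (Suc n) =
     \<lparr>pverts = pverts (point_attach H a b n) \<union> pverts (primary_subgraph H a b (Suc n)),
      parcs = parcs (point_attach H a b n) \<union> parcs (primary_subgraph H a b (Suc n))\<rparr>"

definition attachment_vertices :: "nat \<Rightarrow> (nat \<Rightarrow> 'a) \<Rightarrow> 'a set" where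
  "attachment_vertices k a = {a i | i. Suc i < k}"

definition remove_edges_to ::
  "'a pair_pre_digraph \<Rightarrow> 'a \<Rightarrow> 'a set \<Rightarrow> 'a pair_pre_digraph" where
  "remove_edges_to G x S =
     \<lparr>pverts = pverts G, parcs = parcs G - ({x} \<times> S \<union> S \<times> {x})\<rparr>"

definition component_of :: "('a, 'b) pre_digraph \<Rightarrow> 'a \<Rightarrow> ('a, 'b) pre_digraph" where
  "component_of G x = G \<restriction> {y. x \<rightarrow>\<^sup>*\<^bsub>G\<^esub> y}"

(* the graph written G_j(x^+) *)
definition attached_part ::
  "nat \<Rightarrow> (nat \<Rightarrow> 'a pair_pre_digraph) \<Rightarrow> (nat \<Rightarrow> 'a) \<Rightarrow> (nat \<Rightarrow> 'a) \<Rightarrow> nat \<Rightarrow> 'a \<Rightarrow>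
     ('a, 'a \<times> 'a) pre_digraph" where
  "attached_part k H a b j x =
     component_of
       (with_proj (remove_edges_to (point_attach H a b (k - 1)) x
          (pverts (primary_subgraph H a b j)))) x"

definition nonbipartite_indices :: "nat \<Rightarrow> (nat \<Rightarrow> 'a pair_pre_digraph) \<Rightarrow> nat set" where
  "nonbipartite_indices k H = {j. j < k \<and> \<not> bipartite (with_proj (H j))}"

(* the set C_j *)
definition nonbipartite_attachments ::
  "nat \<Rightarrow> (nat \<Rightarrow> 'a pair_pre_digraph) \<Rightarrow> (nat \<Rightarrow> 'a) \<Rightarrow> (nat \<Rightarrow> 'a) \<Rightarrow> nat \<Rightarrow> 'a set" where
  "nonbipartite_attachments k H a b j =
     {x \<in> attachment_vertices k a. x \<in> pverts (primary_subgraph H a b j) \<and>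
        \<not> bipartite (attached_part k H a b j x)}"

(* the number alpha_j *)
definition attachment_number ::
  "nat \<Rightarrow> (nat \<Rightarrow> 'a pair_pre_digraph) \<Rightarrow> (nat \<Rightarrow> 'a) \<Rightarrow> (nat \<Rightarrow> 'a) \<Rightarrow> nat \<Rightarrow> nat" where
  "attachment_number k H a b j =
     Max {card (nonbipartite_attachments k H a b j \<inter> B) | B.
            local_metric_basis (with_proj (primary_subgraph H a b j)) B}"

end

theory Submission
  imports Defs
begin

text \<open>For each non-bipartite \<open>G\<^sub>j\<close> choose a local metric basis \<open>B\<^sub>j\<close> with \<open>|C\<^sub>j \<inter> B\<^sub>j| = \<alpha>\<^sub>j\<close>; the union \<open>W\<close>
  of the sets \<open>B\<^sub>j - C\<^sub>j\<close> is a local metric generator. Every vertex \<open>w\<close> has a gate in \<open>G\<^sub>j\<close>, through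
  which all shortest paths from \<open>G\<^sub>j\<close> to \<open>w\<close> run, so \<open>w\<close> distinguishes the ends of an edge of \<open>G\<^sub>j\<close>
  iff its gate does. Hence a discarded \<open>x \<in> B\<^sub>j \<inter> C\<^sub>j\<close> may be replaced by any element of \<open>W\<close> whose
  gate in \<open>G\<^sub>j\<close> is \<open>x\<close>. Such an element exists since \<open>G\<^sub>j(x\<^sup>+)\<close>, being non-bipartite, contains a
  non-bipartite primary subgraph; take an outermost one. In a bipartite \<open>G\<^sub>j\<close> every vertex
  distinguishes the ends of every edge.\<close>

section \<open>Distances and two-colourings of relations\<close>

text \<open>Counts walks instead of paths: walks can be concatenated, and projected along a map that
  identifies vertices, without removing repetitions. The minimum is the same by
  \<open>graph_dist_eq_rel_dist\<close>.\<close>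

definition rel_dist :: "'a rel \<Rightarrow> 'a \<Rightarrow> 'a \<Rightarrow> nat" where
  "rel_dist E x y = (LEAST n. (x, y) \<in> E ^^ n)"

definition two_colorable :: "'a rel \<Rightarrow> bool" where
  "two_colorable E \<longleftrightarrow> (\<exists>c :: 'a \<Rightarrow> bool. \<forall>(u, v)\<in>E. c u \<noteq> c v)"

definition resolves :: "'a set \<Rightarrow> 'a rel \<Rightarrow> bool" where
  "resolves W E \<longleftrightarrow> (\<forall>(u, v)\<in>E. \<exists>w\<in>W. rel_dist E u w \<noteq> rel_dist E v w)"

lemma two_colorableI: "(\<And>u v. (u, v) \<in> E \<Longrightarrow> c u \<noteq> (c v :: bool)) \<Longrightarrow> two_colorable E"
  unfolding two_colorable_def by (intro exI[of _ c]) blast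

lemma two_colorable_mono: "two_colorable F \<Longrightarrow> E \<subseteq> F \<Longrightarrow> two_colorable E"
  unfolding two_colorable_def by (meson subsetD)

lemma relpow_mono_rel:
  fixes E F :: "'a rel"
  assumes "F \<subseteq> E"
  shows "F ^^ n \<subseteq> E ^^ n"
  using assms by (induction n) auto

lemma rel_dist_relpow: "(x, y) \<in> E\<^sup>* \<Longrightarrow> (x, y) \<in> E ^^ rel_dist E x y"
  unfolding rel_dist_def by (metis LeastI_ex rtrancl_imp_relpow)

lemma rel_dist_le: "(x, y) \<in> E ^^ n \<Longrightarrow> rel_dist E x y \<le> n"
  unfolding rel_dist_def by (rule Least_le)

lemma rel_dist_triangle:
  assumes "(x, y) \<in> E\<^sup>*" "(y, z) \<in> E\<^sup>*"
  shows "rel_dist E x z \<le> rel_dist E x y + rel_dist E y z"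
  using rel_dist_relpow[OF assms(1)] rel_dist_relpow[OF assms(2)]
  by (auto intro!: rel_dist_le simp: relpow_add)

lemma rel_dist_adjacent:
  assumes "(u, v) \<in> E" "(v, y) \<in> E\<^sup>*"
  shows "rel_dist E u y \<le> Suc (rel_dist E v y)"
  using assms rel_dist_relpow[of v y E] by (blast intro: rel_dist_le relpow_Suc_I2)

text \<open>Every step of a walk flips the colour.\<close>

lemma two_coloring_relpow_parity:
  assumes "\<forall>(u, v)\<in>E. c u \<noteq> c v" "(x, y) \<in> E ^^ n"
  shows "(c x = (c y :: bool)) = even n"
  using assms(2)
proof (induction n arbitrary: y)
  case (Suc n)
  then obtain z where z: "(x, z) \<in> E ^^ n" "(z, y) \<in> E" by auto
  with assms(1) have "c z \<noteq> c y" by auto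
  with Suc.IH[OF z(1)] show ?case by auto
qed simp

text \<open>The ends of an edge have different colours, so their distances to \<open>x\<close> have
  different parity.\<close>

lemma two_colorable_rel_dist_neq:
  assumes "two_colorable E" "(u, v) \<in> E" "(u, x) \<in> E\<^sup>*" "(v, x) \<in> E\<^sup>*"
  shows "rel_dist E u x \<noteq> rel_dist E v x"
proof -
  from assms(1) obtain c :: "'a \<Rightarrow> bool" where c: "\<forall>(u, v)\<in>E. c u \<noteq> c v"
    unfolding two_colorable_def by blast
  have "c u \<noteq> c v" using c assms(2) by auto
  with two_coloring_relpow_parity[OF c rel_dist_relpow[OF assms(3)]]
    two_coloring_relpow_parity[OF c rel_dist_relpow[OF assms(4)]]
  show ?thesis by metis
qed

text \<open>If a single vertex resolves all edges, the parity of the distance to it is a two-colouring.\<close>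

lemma resolves_Diff_singleton_nonempty:
  assumes "sym E" and conn: "\<And>u v. u \<in> V \<Longrightarrow> v \<in> V \<Longrightarrow> (u, v) \<in> E\<^sup>*"
    and "E \<subseteq> V \<times> V" "W \<subseteq> V" and res: "resolves W E" and "\<not> two_colorable E"
  shows "W - {y} \<noteq> {}"
proof
  assume "W - {y} = {}"
  then have sub: "W \<subseteq> {y}" by blast
  have "even (rel_dist E u y) \<noteq> even (rel_dist E v y)" if uv: "(u, v) \<in> E" for u v
  proof -
    obtain w where "w \<in> W" "rel_dist E u w \<noteq> rel_dist E v w"
      using res uv unfolding resolves_def by blast
    with sub assms(4) have y: "y \<in> V" and neq: "rel_dist E u y \<noteq> rel_dist E v y" by auto
    have vu: "(v, u) \<in> E" using uv \<open>sym E\<close> by (auto dest: symD)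
    \<comment> \<open>Distances from adjacent vertices to \<open>y\<close> differ by at most one;
      being different, they differ by exactly one and have opposite parity.\<close>
    have "rel_dist E u y \<le> Suc (rel_dist E v y)" "rel_dist E v y \<le> Suc (rel_dist E u y)"
      using rel_dist_adjacent[OF uv conn] rel_dist_adjacent[OF vu conn] assms(3) uv y by auto
    with neq have "rel_dist E u y = Suc (rel_dist E v y) \<or> rel_dist E v y = Suc (rel_dist E u y)"
      by linarith
    then show ?thesis by auto
  qed
  then have "two_colorable E"
    by (rule two_colorableI)
  with assms(6) show False by blast
qed

section \<open>Retractions onto a subgraph\<close>

text \<open>An edge outside \<open>F\<close> leaves the value of \<open>g\<close> unchanged, so a
  walk that leaves the subgraph at some vertex can only return at that same vertex. It will be used
  with \<open>g\<close> the gate map of a primary subgraph.\<close>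

locale graph_retraction =
  fixes V :: "'a set" and F E :: "'a rel" and g :: "'a \<Rightarrow> 'a"
  assumes F_sub_E: "F \<subseteq> E" and F_sub_V: "F \<subseteq> V \<times> V"
    and retract_id: "y \<in> V \<Longrightarrow> g y = y"
    and collapse: "(u, v) \<in> E \<Longrightarrow> (u, v) \<notin> F \<Longrightarrow> g u = g v"
begin

text \<open>Apply \<open>g\<close> to every vertex of the walk: edges of \<open>F\<close> survive,
  since \<open>g\<close> fixes their ends, and all other edges shrink to a point.\<close>

lemma relpow_project:
  assumes "(u, w) \<in> E ^^ n"
  shows "\<exists>m\<le>n. (g u, g w) \<in> F ^^ m"
  using assms
proof (induction n arbitrary: w)
  case 0
  then show ?case by auto
next
  case (Suc n)
  then obtain z where z: "(u, z) \<in> E ^^ n" "(z, w) \<in> E" by auto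
  from Suc.IH[OF z(1)] obtain m where m: "m \<le> n" "(g u, g z) \<in> F ^^ m" by blast
  show ?case
  proof (cases "(z, w) \<in> F")
    case True
    then have "(g z, g w) \<in> F" using F_sub_V retract_id by auto
    with m show ?thesis by (intro exI[of _ "Suc m"]) auto
  next
    case False
    with collapse[OF z(2)] m show ?thesis by (auto intro!: exI[of _ m])
  qed
qed

text \<open>As the walk grows, an edge of \<open>F\<close> moves the cutting point to the current
  end, and any other edge keeps it in place and lengthens the second piece.\<close>

lemma relpow_via_retract:
  assumes "(u, w) \<in> E ^^ n" "u \<in> V"
  shows "\<exists>m m'. m + m' = n \<and> (u, g w) \<in> E ^^ m \<and> (g w, w) \<in> E ^^ m'"
  using assms(1)
proof (induction n arbitrary: w)
  case 0
  then show ?case using retract_id assms(2) by auto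
next
  case (Suc n)
  then obtain z where z: "(u, z) \<in> E ^^ n" "(z, w) \<in> E" by auto
  from Suc.IH[OF z(1)] obtain m m' where
    m: "m + m' = n" "(u, g z) \<in> E ^^ m" "(g z, z) \<in> E ^^ m'" by blast
  show ?case
  proof (cases "(z, w) \<in> F")
    case True
    then have "g w = w" using F_sub_V retract_id by auto
    with Suc.prems show ?thesis by (intro exI[of _ "Suc n"] exI[of _ 0]) simp
  next
    case False
    with collapse[OF z(2)] have "g z = g w" by simp
    with m z show ?thesis by (intro exI[of _ m] exI[of _ "Suc m'"]) auto
  qed
qed

text \<open>Cut a shortest walk at \<open>g w\<close> for one inequality; the other is the triangle
  inequality. The second summand does not depend on \<open>u\<close>, so \<open>w\<close>
  distinguishes two vertices of \<open>V\<close> exactly when \<open>g w\<close> does.\<close>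

lemma rel_dist_retract:
  assumes "u \<in> V" "(u, w) \<in> E\<^sup>*"
  shows "rel_dist E u w = rel_dist E u (g w) + rel_dist E (g w) w"
proof -
  obtain m m' where m: "m + m' = rel_dist E u w" "(u, g w) \<in> E ^^ m" "(g w, w) \<in> E ^^ m'"
    using relpow_via_retract[OF rel_dist_relpow[OF assms(2)] assms(1)] by blast
  then have "rel_dist E u (g w) + rel_dist E (g w) w \<le> rel_dist E u w"
    using rel_dist_le[OF m(2)] rel_dist_le[OF m(3)] by linarith
  moreover have "rel_dist E u w \<le> rel_dist E u (g w) + rel_dist E (g w) w"
    using m by (intro rel_dist_triangle) (auto dest: relpow_imp_rtrancl)
  ultimately show ?thesis by linarith
qed

text \<open>A walk in \<open>F\<close> is a walk in \<open>E\<close>, and a walk in \<open>E\<close>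
  projects to one in \<open>F\<close> that is no longer.\<close>

lemma rel_dist_isometric:
  assumes "u \<in> V" "v \<in> V" "(u, v) \<in> F\<^sup>*"
  shows "rel_dist E u v = rel_dist F u v"
proof (rule antisym)
  have "(u, v) \<in> E ^^ rel_dist F u v"
    using rel_dist_relpow[OF assms(3)] relpow_mono_rel[OF F_sub_E] by blast
  then show "rel_dist E u v \<le> rel_dist F u v" by (rule rel_dist_le)
  have "(u, v) \<in> E\<^sup>*" using assms(3) rtrancl_mono[OF F_sub_E] by blast
  from relpow_project[OF rel_dist_relpow[OF this]] obtain m
    where "m \<le> rel_dist E u v" "(g u, g v) \<in> F ^^ m" by blast
  then show "rel_dist F u v \<le> rel_dist E u v"
    using retract_id assms rel_dist_le[of "g u" "g v" m F] by auto
qed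

end

section \<open>Point-attached families\<close>

text \<open>The primary subgraphs are regarded as already lying in the common graph, so that each
  identification becomes a statement on intersections: by \<open>glue\<close>, a new subgraph meets
  everything older in exactly one vertex.\<close>

locale point_attached =
  fixes k :: nat and V :: "nat \<Rightarrow> 'a set" and E :: "nat \<Rightarrow> 'a rel" and a :: "nat \<Rightarrow> 'a"
  assumes finite_V: "l < k \<Longrightarrow> finite (V l)"
    and nonempty_V: "l < k \<Longrightarrow> V l \<noteq> {}"
    and E_sub: "l < k \<Longrightarrow> E l \<subseteq> V l \<times> V l"
    and sym_E: "l < k \<Longrightarrow> sym (E l)"
    and conn_E: "l < k \<Longrightarrow> u \<in> V l \<Longrightarrow> v \<in> V l \<Longrightarrow> (u, v) \<in> (E l)\<^sup>*"
    and glue: "Suc i < k \<Longrightarrow> V (Suc i) \<inter> (\<Union>l\<le>i. V l) = {a i}"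
begin

section \<open>The union of the primary subgraphs and the gates onto each of them\<close>

definition verts_all :: "'a set" where "verts_all = (\<Union>l<k. V l)"

definition edges_all :: "'a rel" where "edges_all = (\<Union>l<k. E l)"

text \<open>Relational counterpart of the edges of \<open>attached_part\<close>; \<open>D\<close>
  consists of the edges left after separating \<open>x\<close> from G_j.\<close>

definition part_edges :: "nat \<Rightarrow> 'a \<Rightarrow> 'a rel" where
  "part_edges j x = (let D = edges_all - ({x} \<times> V j \<union> V j \<times> {x})
     in {(u, v) \<in> D. (x, u) \<in> D\<^sup>* \<and> (x, v) \<in> D\<^sup>*})"

text \<open>The last condition says that every other primary subgraph is seen from G_j through a
  single vertex. The stage \<open>n\<close> is a parameter to permit induction along the
  construction.\<close>

definition is_gate :: "nat \<Rightarrow> nat \<Rightarrow> ('a \<Rightarrow> 'a) \<Rightarrow> bool" where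
  "is_gate n j g \<longleftrightarrow> (\<forall>y\<in>V j. g y = y) \<and> (\<forall>l\<le>n. g ` V l \<subseteq> V j) \<and>
     (\<forall>l\<le>n. l \<noteq> j \<longrightarrow> (\<exists>c. \<forall>y\<in>V l. g y = c))"

text \<open>Induction on the attaching steps. If the new subgraph is G_j, all older vertices are
  sent to the attachment vertex; otherwise the new subgraph inherits the gate of its attachment
  vertex.\<close>

lemma is_gate_exists:
  assumes "n < k" "j \<le> n"
  shows "\<exists>g. is_gate n j g"
  using assms
proof (induction n)
  case 0
  then show ?case by (intro exI[of _ id]) (simp add: is_gate_def)
next
  case (Suc n)
  have an: "V (Suc n) \<inter> (\<Union>l\<le>n. V l) = {a n}" using glue Suc.prems by simp
  show ?case
  proof (cases "j = Suc n")
    case True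
    define g where "g y = (if y \<in> V (Suc n) then y else a n)" for y
    \<comment> \<open>The only older vertex in the new subgraph is \<open>a n\<close>, where both
      branches of \<open>g\<close> agree.\<close>
    have "g y = a n" if "y \<in> V l" "l \<le> n" for y l
    proof (cases "y \<in> V (Suc n)")
      case True
      then have "y \<in> {a n}" using that an by blast
      then show ?thesis by (simp add: g_def)
    qed (simp add: g_def)
    moreover have "a n \<in> V (Suc n)" using an by blast
    ultimately have "is_gate (Suc n) j g"
      unfolding is_gate_def using True by (auto simp: le_Suc_eq g_def)
    then show ?thesis by blast
  next
    case False
    with Suc obtain g where g: "is_gate n j g" by auto
    define h where "h y = (if y \<in> V (Suc n) then g (a n) else g y)" for y
    have h_old: "h y = g y" if "y \<in> V l" "l \<le> n" for y l
    proof (cases "y \<in> V (Suc n)")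
      case True
      then have "y \<in> {a n}" using that an by blast
      then show ?thesis by (simp add: h_def)
    qed (simp add: h_def)
    have jn: "j \<le> n" using False Suc.prems by simp
    have an_old: "\<exists>l\<le>n. a n \<in> V l" using an by blast
    have 1: "\<forall>y\<in>V j. h y = y" using h_old jn g unfolding is_gate_def by auto
    have 2: "h ` V l \<subseteq> V j" if "l \<le> Suc n" for l
    proof (cases "l = Suc n")
      case True
      then show ?thesis using an_old g unfolding is_gate_def h_def by auto
    next
      case False
      then have "l \<le> n" using that by simp
      then show ?thesis using h_old g unfolding is_gate_def by auto
    qed
    have 3: "\<exists>c. \<forall>y\<in>V l. h y = c" if "l \<le> Suc n" "l \<noteq> j" for l
    proof (cases "l = Suc n")
      case True
      then show ?thesis unfolding h_def by auto
    next
      case False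
      then have "l \<le> n" using that by simp
      moreover have "\<forall>l\<le>n. l \<noteq> j \<longrightarrow> (\<exists>c. \<forall>y\<in>V l. g y = c)"
        using g unfolding is_gate_def by simp
      ultimately obtain c where "\<forall>y\<in>V l. g y = c" using \<open>l \<noteq> j\<close> by meson
      then show ?thesis using h_old \<open>l \<le> n\<close> by (intro exI[of _ c]) simp
    qed
    show ?thesis unfolding is_gate_def using 1 2 3 by blast
  qed
qed

definition gate :: "nat \<Rightarrow> 'a \<Rightarrow> 'a" where
  "gate j = (SOME g. is_gate (k - 1) j g)"

lemma is_gate_gate: "j < k \<Longrightarrow> is_gate (k - 1) j (gate j)"
  unfolding gate_def using is_gate_exists[of "k - 1" j] someI_ex[of "is_gate (k - 1) j"] by simp

lemma gate_id: "j < k \<Longrightarrow> y \<in> V j \<Longrightarrow> gate j y = y"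
  using is_gate_gate[of j] unfolding is_gate_def by simp

lemma gate_in: "j < k \<Longrightarrow> y \<in> verts_all \<Longrightarrow> gate j y \<in> V j"
proof -
  assume j: "j < k" and "y \<in> verts_all"
  then obtain l where l: "l < k" "y \<in> V l" unfolding verts_all_def by blast
  then have "l \<le> k - 1" by simp
  moreover have "\<forall>l\<le>k - 1. gate j ` V l \<subseteq> V j"
    using is_gate_gate[OF j] unfolding is_gate_def by simp
  ultimately show "gate j y \<in> V j" using l(2) by (meson image_subset_iff)
qed

lemma gate_const:
  assumes "j < k" "l < k" "l \<noteq> j" "y \<in> V l" "z \<in> V l"
  shows "gate j y = gate j z"
proof -
  have "l \<le> k - 1" using assms by simp
  moreover have "\<forall>l\<le>k - 1. l \<noteq> j \<longrightarrow> (\<exists>c. \<forall>y\<in>V l. gate j y = c)"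
    using is_gate_gate[OF assms(1)] unfolding is_gate_def by simp
  ultimately obtain c where "\<forall>y\<in>V l. gate j y = c" using assms(3) by meson
  with assms show ?thesis by simp
qed

lemma edges_allE:
  assumes "(u, v) \<in> edges_all"
  obtains l where "l < k" "(u, v) \<in> E l" "u \<in> V l" "v \<in> V l"
  using assms E_sub unfolding edges_all_def by blast

text \<open>An edge outside G_j belongs to another primary subgraph, on which the gate is constant.
  This makes the distance formulas for retractions available.\<close>

lemma gate_retraction: "j < k \<Longrightarrow> graph_retraction (V j) (E j) edges_all (gate j)"
proof
  assume j: "j < k"
  show "E j \<subseteq> edges_all" using j unfolding edges_all_def by blast
  show "E j \<subseteq> V j \<times> V j" using E_sub j .
  show "gate j y = y" if "y \<in> V j" for y using gate_id j that .
  show "gate j u = gate j v" if uv: "(u, v) \<in> edges_all" "(u, v) \<notin> E j" for u v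
  proof -
    obtain l where "l < k" "(u, v) \<in> E l" "u \<in> V l" "v \<in> V l" using uv(1) by (rule edges_allE)
    moreover from this uv(2) have "l \<noteq> j" by blast
    ultimately show ?thesis using gate_const[OF j] by blast
  qed
qed

section \<open>Connectedness and the comparison of two gates\<close>

lemma sym_edges_all: "sym edges_all"
  unfolding edges_all_def using sym_E by (auto simp: sym_def)

text \<open>Each vertex of a newly attached subgraph is joined to the attachment vertex, which by
  induction is joined to every vertex of \<open>V 0\<close>.\<close>

lemma conn_edges_all:
  assumes "u \<in> verts_all" "v \<in> verts_all"
  shows "(u, v) \<in> edges_all\<^sup>*"
proof -
  have loc: "(u, v) \<in> edges_all\<^sup>*" if "l < k" "u \<in> V l" "v \<in> V l" for l u v
  proof -
    have "E l \<subseteq> edges_all" using that unfolding edges_all_def by blast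
    then show ?thesis using conn_E[OF that] rtrancl_mono by blast
  qed
  have root: "\<forall>u\<in>(\<Union>l\<le>n. V l). \<forall>r\<in>V 0. (u, r) \<in> edges_all\<^sup>*" if "n < k" for n
    using that
  proof (induction n)
    case 0
    then show ?case using loc by auto
  next
    case (Suc n)
    have an: "V (Suc n) \<inter> (\<Union>l\<le>n. V l) = {a n}" using glue Suc.prems by simp
    then have an': "a n \<in> V (Suc n)" "a n \<in> (\<Union>l\<le>n. V l)" by blast+
    show ?case
    proof (intro ballI)
      fix u r assume u: "u \<in> (\<Union>l\<le>Suc n. V l)" and r: "r \<in> V 0"
      show "(u, r) \<in> edges_all\<^sup>*"
      proof (cases "u \<in> V (Suc n)")
        case True
        then have "(u, a n) \<in> edges_all\<^sup>*" using loc an' Suc.prems by blast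
        moreover have "(a n, r) \<in> edges_all\<^sup>*" using Suc.IH Suc.prems an' r by (meson Suc_lessD)
        ultimately show ?thesis by (rule rtrancl_trans)
      next
        case False
        then have "u \<in> (\<Union>l\<le>n. V l)" using u by (auto simp: le_Suc_eq)
        then show ?thesis using Suc.IH Suc.prems r by (meson Suc_lessD)
      qed
    qed
  qed
  have k: "0 < k" "k - 1 < k" using assms unfolding verts_all_def by auto
  then obtain r where r: "r \<in> V 0" using nonempty_V by blast
  have "x \<in> (\<Union>l\<le>k - 1. V l)" if "x \<in> verts_all" for x
    using that unfolding verts_all_def by fastforce
  then have "(u, r) \<in> edges_all\<^sup>*" "(v, r) \<in> edges_all\<^sup>*" using root[OF k(2)] r assms by blast+
  moreover have "(r, v) \<in> edges_all\<^sup>*"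
    using \<open>(v, r) \<in> edges_all\<^sup>*\<close> sym_rtrancl[OF sym_edges_all] by (auto dest: symD)
  ultimately show ?thesis by (blast intro: rtrancl_trans)
qed

text \<open>The property is inherited along every edge: an edge of \<open>G\<^sub>l\<close> or \<open>G\<^sub>j\<close> satisfies it at both
  ends, and every other edge is collapsed by both gates.\<close>

lemma gate_alternative:
  assumes j: "j < k" and l: "l < k" and "l \<noteq> j" and p: "p \<in> V j" and q: "q \<in> V l"
    and w: "w \<in> verts_all"
  shows "gate l w = gate l p \<or> gate j w = gate j q"
proof -
  interpret rj: graph_retraction "V j" "E j" edges_all "gate j" by (rule gate_retraction[OF j])
  interpret rl: graph_retraction "V l" "E l" edges_all "gate l" by (rule gate_retraction[OF l])
  have "q \<in> verts_all" using q l unfolding verts_all_def by blast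
  \<comment> \<open>Follow a walk from \<open>q\<close> to \<open>w\<close>; at \<open>q\<close> the
    second alternative is trivial.\<close>
  then have "(q, w) \<in> edges_all\<^sup>*" using w by (rule conn_edges_all)
  then show ?thesis
  proof (induction rule: rtrancl_induct)
    case (step y z)
    show ?case
    proof (cases "(y, z) \<in> E j \<or> (y, z) \<in> E l")
      case True
      then have "z \<in> V j \<or> z \<in> V l" using E_sub j l by blast
      then show ?thesis using gate_const[OF l j, of z p] gate_const[OF j l, of z q] assms by auto
    next
      case False
      then show ?thesis using rj.collapse[OF step(2)] rl.collapse[OF step(2)] step.IH by simp
    qed
  qed simp
qed

section \<open>Gluing two-colourings, and non-bipartite attached parts\<close>

text \<open>A new subgraph shares one vertex with the older ones, so its colouring can be matched
  there, after inversion if necessary. The index set is arbitrary so that the lemma also covers the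
  subgraphs behind one attachment vertex.\<close>

lemma two_colorable_Union:
  assumes "\<And>l. l \<in> L \<Longrightarrow> l < k \<and> two_colorable (E l)"
  shows "two_colorable (\<Union>l\<in>L. E l)"
proof -
  have "\<exists>c :: 'a \<Rightarrow> bool. \<forall>l\<in>L. l \<le> n \<longrightarrow> (\<forall>(u, v)\<in>E l. c u \<noteq> c v)" if "n < k" for n
    using that
  proof (induction n)
    case 0
    show ?case
    proof (cases "0 \<in> L")
      case True
      then show ?thesis using assms unfolding two_colorable_def by simp
    qed auto
  next
    case (Suc n)
    then obtain c :: "'a \<Rightarrow> bool" where c: "\<forall>l\<in>L. l \<le> n \<longrightarrow> (\<forall>(u, v)\<in>E l. c u \<noteq> c v)" by auto
    have an: "V (Suc n) \<inter> (\<Union>l\<le>n. V l) = {a n}" using glue Suc.prems by simp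
    show ?case
    proof (cases "Suc n \<in> L")
      case False
      then show ?thesis using c by (metis le_SucE)
    next
      case True
      then obtain d :: "'a \<Rightarrow> bool" where d: "\<forall>(u, v)\<in>E (Suc n). d u \<noteq> d v"
        using assms unfolding two_colorable_def by blast
      \<comment> \<open>On the new subgraph \<open>d\<close> is kept or inverted according to
        whether it agrees with \<open>c\<close> at \<open>a n\<close>; in both cases
        \<open>f (a n) = c (a n)\<close>.\<close>
      define f where "f y = (if y \<in> V (Suc n) then (d y = (d (a n) = c (a n))) else c y)" for y
      have f_old: "f y = c y" if "y \<in> V l" "l \<le> n" for y l
      proof (cases "y \<in> V (Suc n)")
        case True
        then have "y \<in> {a n}" using that an by blast
        then show ?thesis by (auto simp: f_def)
      qed (simp add: f_def)
      have "f u \<noteq> f v" if l: "l \<in> L" "l \<le> Suc n" and uv: "(u, v) \<in> E l" for l u v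
      proof (cases "l = Suc n")
        case True
        then have "u \<in> V (Suc n)" "v \<in> V (Suc n)" using uv E_sub Suc.prems by blast+
        moreover have "d u \<noteq> d v" using d uv True by auto
        ultimately show ?thesis unfolding f_def by auto
      next
        case False
        then have ln: "l \<le> n" using l by simp
        then have "u \<in> V l" "v \<in> V l" using uv E_sub[of l] Suc.prems by auto
        then have "f u = c u" "f v = c v" using f_old ln by blast+
        moreover have "c u \<noteq> c v" using c l(1) ln uv by blast
        ultimately show ?thesis by simp
      qed
      then show ?thesis by blast
    qed
  qed
  note coloring = this
  show ?thesis
  proof (cases "L = {}")
    case True
    then show ?thesis unfolding two_colorable_def by simp
  next
    case False
    then have "k - 1 < k" using assms by fastforce
    then obtain c :: "'a \<Rightarrow> bool" where
      c: "\<forall>l\<in>L. l \<le> k - 1 \<longrightarrow> (\<forall>(u, v)\<in>E l. c u \<noteq> c v)" using coloring by blast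
    have "c u \<noteq> c v" if uv: "(u, v) \<in> (\<Union>l\<in>L. E l)" for u v
    proof -
      obtain l where l: "l \<in> L" "(u, v) \<in> E l" using uv by blast
      from assms[OF l(1)] have "l \<le> k - 1" by auto
      with c l(1) have "\<forall>(u, v)\<in>E l. c u \<noteq> c v" by simp
      from bspec[OF this l(2)] show ?thesis by simp
    qed
    then show ?thesis by (rule two_colorableI)
  qed
qed

text \<open>Along a walk in \<open>D\<close> starting at \<open>x\<close> the gate stays
  \<open>x\<close>: an edge of G_j on it would start at a vertex of G_j with gate \<open>x\<close>,
  thus at \<open>x\<close> itself, and those edges were removed; all other edges are
  collapsed.\<close>

lemma part_edges_gate:
  assumes j: "j < k" and x: "x \<in> V j" and uv: "(u, v) \<in> part_edges j x"
  shows "\<exists>l<k. l \<noteq> j \<and> (u, v) \<in> E l \<and> (\<forall>y\<in>V l. gate j y = x)"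
proof -
  define D where "D = edges_all - ({x} \<times> V j \<union> V j \<times> {x})"
  interpret graph_retraction "V j" "E j" edges_all "gate j" by (rule gate_retraction[OF j])
  have uv': "(u, v) \<in> D" "(x, u) \<in> D\<^sup>*"
    using uv unfolding part_edges_def D_def Let_def by auto
  have u: "gate j u = x"
    using uv'(2)
  proof (induction rule: rtrancl_induct)
    case base
    then show ?case using gate_id j x .
  next
    case (step y z)
    have "(y, z) \<notin> E j"
    proof
      assume "(y, z) \<in> E j"
      then have yz: "y \<in> V j" "z \<in> V j" using E_sub j by blast+
      then have "y = x" using step.IH gate_id j by simp
      then show False using step(2) yz unfolding D_def by blast
    qed
    then show ?case using collapse[of y z] step unfolding D_def by auto
  qed
  obtain l where l: "l < k" "(u, v) \<in> E l" "u \<in> V l" "v \<in> V l"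
    using uv'(1) unfolding D_def by (blast elim: edges_allE)
  have "l \<noteq> j"
  proof
    assume "l = j"
    then have "u = x" using u gate_id l by simp
    then show False using uv'(1) l \<open>l = j\<close> unfolding D_def by blast
  qed
  moreover from this have "\<forall>y\<in>V l. gate j y = x" using l u gate_const[OF j l(1)] by blast
  ultimately show ?thesis using l by blast
qed

text \<open>All edges of the attached part lie in primary subgraphs with gate \<open>x\<close>; if
  these were all bipartite, their union could be two-coloured.\<close>

lemma part_edges_nonbipartite_primary:
  assumes "j < k" "x \<in> V j" "\<not> two_colorable (part_edges j x)"
  shows "\<exists>l<k. l \<noteq> j \<and> \<not> two_colorable (E l) \<and> (\<forall>y\<in>V l. gate j y = x)"
proof (rule ccontr)
  assume none: "\<not> ?thesis"
  define L where "L = {l. l < k \<and> l \<noteq> j \<and> (\<forall>y\<in>V l. gate j y = x)}"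
  have "l < k \<and> two_colorable (E l)" if "l \<in> L" for l
    using none that unfolding L_def by blast
  then have "two_colorable (\<Union>l\<in>L. E l)" by (rule two_colorable_Union)
  moreover have "part_edges j x \<subseteq> (\<Union>l\<in>L. E l)"
  proof (rule subrelI)
    fix u v assume "(u, v) \<in> part_edges j x"
    from part_edges_gate[OF assms(1,2) this] obtain l where "l \<in> L" "(u, v) \<in> E l"
      unfolding L_def by auto
    then show "(u, v) \<in> (\<Union>l\<in>L. E l)" by (rule UN_I)
  qed
  ultimately show False using assms(3) two_colorable_mono by metis
qed

text \<open>Walking away from \<open>G\<^sub>j\<close> one reaches a non-bipartite primary subgraph \<open>G\<^sub>l\<close> all of whose
  elements of \<open>C l\<close> equal the gate towards \<open>G\<^sub>j\<close>; since no single vertex resolves \<open>G\<^sub>l\<close>, some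
  element of \<open>B l\<close> survives.\<close>

lemma part_contains_landmark:
  assumes C: "\<And>j x. j < k \<Longrightarrow> x \<in> C j \<Longrightarrow> x \<in> V j \<and> \<not> two_colorable (part_edges j x)"
    and B: "\<And>j. j < k \<Longrightarrow> B j \<subseteq> V j \<and> resolves (B j) (E j)"
    and "j < k" "x \<in> V j" "\<not> two_colorable (part_edges j x)"
  shows "\<exists>l<k. \<not> two_colorable (E l) \<and> (\<exists>w\<in>B l - C l. gate j w = x)"
  using assms(3-)
\<comment> \<open>The measure is the number of vertices lying behind \<open>x\<close> as seen from
  G_j; it drops when moving outwards.\<close>
proof (induction "card {y \<in> verts_all. gate j y = x}" arbitrary: j x rule: less_induct)
  case less
  obtain l where l: "l < k" "l \<noteq> j" "\<not> two_colorable (E l)" and gl: "\<And>y. y \<in> V l \<Longrightarrow> gate j y = x"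
    using part_edges_nonbipartite_primary[OF less.prems] by auto
  \<comment> \<open>The vertex of G_l that faces G_j.\<close>
  define y where "y = gate l x"
  have Vall: "V i \<subseteq> verts_all" if "i < k" for i using that unfolding verts_all_def by blast
  have yV: "y \<in> V l" unfolding y_def using gate_in l less.prems Vall by blast
  show ?case
  proof (cases "C l \<subseteq> {y}")
    case True
    have "B l - {y} \<noteq> {}"
      using resolves_Diff_singleton_nonempty[of "E l" "V l" "B l" y] sym_E conn_E E_sub B l by blast
    then obtain w where w: "w \<in> B l - C l" using True by blast
    then have "gate j w = x" using B gl l by blast
    then show ?thesis using l w by blast
  next
    case False
    then obtain z where z: "z \<in> C l" "z \<noteq> y" by blast
    have zV: "z \<in> V l" "\<not> two_colorable (part_edges l z)" using C z l by blast+
    \<comment> \<open>What lies behind \<open>z\<close> as seen from G_l has a gate in G_l other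
      than \<open>y = gate l x\<close>, so its gate in G_j must be that of \<open>y\<close>, namely
      \<open>x\<close>.\<close>
    have sub: "gate j w = x" if "w \<in> verts_all" "gate l w = z" for w
      using gate_alternative[OF less.prems(1) l(1,2) less.prems(2) yV that(1)] that z gl[OF yV] y_def
      by auto
    have "{w \<in> verts_all. gate l w = z} \<subset> {w \<in> verts_all. gate j w = x}"
    proof
      show "{w \<in> verts_all. gate l w = z} \<subseteq> {w \<in> verts_all. gate j w = x}" using sub by blast
      \<comment> \<open>The inclusion is strict because of \<open>y\<close>, whose gate in G_j is
        \<open>x\<close> and whose gate in G_l is \<open>y\<close> itself.\<close>
      have "y \<in> {w \<in> verts_all. gate j w = x}" using yV gl Vall l by blast
      moreover have "y \<notin> {w \<in> verts_all. gate l w = z}" using gate_id yV l z by simp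
      ultimately show "{w \<in> verts_all. gate l w = z} \<noteq> {w \<in> verts_all. gate j w = x}" by blast
    qed
    moreover have "finite verts_all" using finite_V unfolding verts_all_def by blast
    ultimately have "card {w \<in> verts_all. gate l w = z} < card {w \<in> verts_all. gate j w = x}"
      by (intro psubset_card_mono) auto
    from less.hyps[OF this l(1) zV] obtain m w where m: "m < k" "\<not> two_colorable (E m)"
      "w \<in> B m - C m" "gate l w = z" by blast
    have "w \<in> verts_all" using m B Vall by blast
    then show ?thesis using sub m by blast
  qed
qed

text \<open>The theorem without its cardinalities: \<open>B j\<close> is any resolving set and
  \<open>C j\<close> any set of vertices with non-bipartite attached part. Each edge is treated
  inside its own primary subgraph and the result is carried over by the gate.\<close>

lemma resolves_point_attached:
  assumes C: "\<And>j x. j < k \<Longrightarrow> x \<in> C j \<Longrightarrow> x \<in> V j \<and> \<not> two_colorable (part_edges j x)"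
    and B: "\<And>j. j < k \<Longrightarrow> B j \<subseteq> V j \<and> resolves (B j) (E j)"
    and nonbip: "\<not> two_colorable edges_all"
  defines "W \<equiv> (\<Union>j\<in>{j. j < k \<and> \<not> two_colorable (E j)}. B j - C j)"
  shows "resolves W edges_all"
proof -
  have Vall: "V i \<subseteq> verts_all" if "i < k" for i using that unfolding verts_all_def by blast
  have Wall: "W \<subseteq> verts_all" unfolding W_def using B Vall by blast
  have landmark: "\<exists>w\<in>W. gate j w = x" if jx: "j < k" "x \<in> C j" for j x
  proof -
    obtain l w where "l < k" "\<not> two_colorable (E l)" "w \<in> B l - C l" "gate j w = x"
      using part_contains_landmark[where C = C and B = B, OF C B jx(1)] C[OF jx] by blast
    then show ?thesis unfolding W_def by blast
  qed
  have "\<exists>l<k. \<not> two_colorable (E l)"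
    using two_colorable_Union[of "{..<k}"] nonbip unfolding edges_all_def by blast
  then obtain l where l: "l < k" "\<not> two_colorable (E l)" by blast
  \<comment> \<open>Edges of bipartite primary subgraphs are distinguished by every vertex, so one
    element of \<open>W\<close> will serve them all.\<close>
  have "W \<noteq> {}"
  proof (cases "C l = {}")
    case True
    \<comment> \<open>The removed vertex is arbitrary; only \<open>B l \<noteq> {}\<close> is
      wanted.\<close>
    have "B l - {undefined} \<noteq> {}"
      using resolves_Diff_singleton_nonempty[of "E l" "V l" "B l"] sym_E conn_E E_sub B l by blast
    then show ?thesis using True l unfolding W_def by blast
  next
    case False
    then show ?thesis using landmark l by blast
  qed
  then obtain w0 where w0: "w0 \<in> W" by blast
  have "\<exists>w\<in>W. rel_dist edges_all u w \<noteq> rel_dist edges_all v w" if uv: "(u, v) \<in> edges_all" for u v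
  proof -
    obtain i where i: "i < k" "(u, v) \<in> E i" "u \<in> V i" "v \<in> V i" using uv by (rule edges_allE)
    interpret graph_retraction "V i" "E i" edges_all "gate i" by (rule gate_retraction[OF i(1)])
    \<comment> \<open>Distances to the gate are the same in G_i and in the whole graph, and the
      remaining distance from the gate to \<open>w\<close> is common to \<open>u\<close> and
      \<open>v\<close>.\<close>
    have transfer: "rel_dist edges_all u w \<noteq> rel_dist edges_all v w"
      if w: "w \<in> verts_all" and neq: "rel_dist (E i) u (gate i w) \<noteq> rel_dist (E i) v (gate i w)" for w
    proof -
      have g: "gate i w \<in> V i" using gate_in i w by blast
      have "rel_dist edges_all u (gate i w) \<noteq> rel_dist edges_all v (gate i w)"
        using neq rel_dist_isometric i g conn_E by auto
      moreover have "(u, w) \<in> edges_all\<^sup>*" "(v, w) \<in> edges_all\<^sup>*"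
        using conn_edges_all w i Vall by blast+
      ultimately show ?thesis using rel_dist_retract[of u w] rel_dist_retract[of v w] i by simp
    qed
    show ?thesis
    proof (cases "two_colorable (E i)")
      case True
      have "gate i w0 \<in> V i" using gate_in i w0 Wall by blast
      then have "rel_dist (E i) u (gate i w0) \<noteq> rel_dist (E i) v (gate i w0)"
        using two_colorable_rel_dist_neq[OF True i(2)] conn_E i by blast
      then show ?thesis using transfer w0 Wall by blast
    next
      case False
      obtain w where w: "w \<in> B i" "rel_dist (E i) u w \<noteq> rel_dist (E i) v w"
        using B[OF i(1)] i(2) unfolding resolves_def by blast
      \<comment> \<open>A discarded \<open>w\<close> is replaced by an element of \<open>W\<close>
        behind it; otherwise \<open>w\<close> is its own gate.\<close>
      obtain w' where w': "w' \<in> W" "gate i w' = w"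
      proof (cases "w \<in> C i")
        case True
        then show thesis using landmark[OF i(1)] that by blast
      next
        case wC: False
        then have "w \<in> W" using w(1) False i(1) unfolding W_def by blast
        moreover have "gate i w = w" using gate_id[OF i(1)] w(1) B[OF i(1)] by blast
        ultimately show thesis using that by blast
      qed
      then have "rel_dist (E i) u (gate i w') \<noteq> rel_dist (E i) v (gate i w')" using w by simp
      then show ?thesis using transfer w'(1) Wall by blast
    qed
  qed
  then show ?thesis unfolding resolves_def by blast
qed

end
section \<open>Translation to graphs\<close>

text \<open>Cutting out a cycle never lengthens a walk.\<close>

lemma (in wf_digraph) awalk_imp_shorter_apath:
  assumes "awalk u p v"
  shows "\<exists>q. apath u q v \<and> length q \<le> length p"
  using assms
proof (induct rule: awalk_to_apath_induct)
  case (path p)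
  then show ?case by (auto simp: apath_def)
next
  case (decomp p q r s)
  then have "length (q @ s) \<le> length p" by (auto elim!: awalk_cyc_decompE)
  with decomp(4) show ?case using le_trans by blast
qed

lemma (in pair_wf_digraph) awalk_relpow:
  assumes "x \<in> pverts G"
  shows "(\<exists>p. awalk x p y \<and> length p = n) \<longleftrightarrow> (x, y) \<in> parcs G ^^ n"
  using assms
proof (induction n arbitrary: x)
  case 0
  then show ?case by (auto simp: awalk_Nil_iff)
next
  case (Suc n)
  have "(\<exists>p. awalk x p y \<and> length p = Suc n) \<longleftrightarrow>
      (\<exists>z. (x, z) \<in> parcs G \<and> (\<exists>p. awalk z p y \<and> length p = n))"
  proof
    assume "\<exists>p. awalk x p y \<and> length p = Suc n"
    then obtain e q where "awalk x (e # q) y" "length q = n" by (metis length_Suc_conv)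
    then show "\<exists>z. (x, z) \<in> parcs G \<and> (\<exists>p. awalk z p y \<and> length p = n)"
      by (intro exI[of _ "snd e"]) (auto simp: awalk_Cons_iff)
  next
    assume "\<exists>z. (x, z) \<in> parcs G \<and> (\<exists>p. awalk z p y \<and> length p = n)"
    then obtain z q where "(x, z) \<in> parcs G" "awalk z q y" "length q = n" by blast
    then show "\<exists>p. awalk x p y \<and> length p = Suc n"
      by (intro exI[of _ "(x, z) # q"]) (auto simp: awalk_Cons_iff)
  qed
  also have "\<dots> \<longleftrightarrow> (\<exists>z. (x, z) \<in> parcs G \<and> (z, y) \<in> parcs G ^^ n)"
    using Suc.IH in_arcsD2 by blast
  also have "\<dots> \<longleftrightarrow> (x, y) \<in> parcs G ^^ Suc n"
    by (meson relpow_Suc_D2 relpow_Suc_I2)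
  finally show ?case .
qed

text \<open>Applied to the lengths of paths and of walks: paths are walks, and below each walk there
  is a path.\<close>

lemma Least_cofinal_eq:
  fixes P Q :: "nat \<Rightarrow> bool"
  assumes "\<And>n. P n \<Longrightarrow> Q n" "\<And>n. Q n \<Longrightarrow> \<exists>m\<le>n. P m"
  shows "(LEAST n. P n) = (LEAST n. Q n)"
proof (cases "\<exists>n. Q n")
  case True
  then have Q: "Q (LEAST n. Q n)" by (rule LeastI_ex)
  then obtain m where m: "m \<le> (LEAST n. Q n)" "P m" using assms(2) by blast
  show ?thesis
  proof (rule antisym)
    show "(LEAST n. P n) \<le> (LEAST n. Q n)" using m Least_le[of P m] by linarith
    show "(LEAST n. Q n) \<le> (LEAST n. P n)" using assms(1)[OF LeastI[of P, OF m(2)]] by (rule Least_le)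
  qed
next
  case False
  \<comment> \<open>Covers unreachable vertices: both minima are the same unspecified
    number.\<close>
  then have "P = Q" using assms(1) by blast
  then show ?thesis by simp
qed

lemma (in pair_wf_digraph) graph_dist_eq_rel_dist:
  assumes "x \<in> pverts G"
  shows "graph_dist (with_proj G) x y = rel_dist (parcs G) x y"
  unfolding graph_dist_def rel_dist_def awalk_relpow[OF assms, symmetric]
proof (rule Least_cofinal_eq)
  show "\<exists>p. awalk x p y \<and> length p = n" if "\<exists>p. apath x p y \<and> length p = n" for n
    using that awalkI_apath by blast
  show "\<exists>m\<le>n. \<exists>p. apath x p y \<and> length p = m" if "\<exists>p. awalk x p y \<and> length p = n" for n
    using that awalk_imp_shorter_apath by blast
qed

lemma (in pair_wf_digraph) local_metric_generator_iff:
  "local_metric_generator (with_proj G) W \<longleftrightarrow> W \<subseteq> pverts G \<and> resolves W (parcs G)"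
proof -
  have "(\<exists>w\<in>W. graph_dist (with_proj G) u w \<noteq> graph_dist (with_proj G) v w) \<longleftrightarrow>
      (\<exists>w\<in>W. rel_dist (parcs G) u w \<noteq> rel_dist (parcs G) v w)" if "(u, v) \<in> parcs G" for u v
    using graph_dist_eq_rel_dist[OF in_arcsD1[OF that]] graph_dist_eq_rel_dist[OF in_arcsD2[OF that]]
    by simp
  then show ?thesis unfolding local_metric_generator_def resolves_def by auto
qed

text \<open>Stated for general pre-digraphs, since \<open>attached_part\<close> is an induced
  subgraph that is not given as a \<open>pair_pre_digraph\<close>.\<close>

lemma bipartite_iff_two_colorable:
  assumes "arcs_ends G \<subseteq> verts G \<times> verts G"
  shows "bipartite G \<longleftrightarrow> two_colorable (arcs_ends G)"
proof
  assume "bipartite G"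
  then obtain X Y where XY: "X \<inter> Y = {}"
    "\<And>u v. (u, v) \<in> arcs_ends G \<Longrightarrow> u \<in> X \<and> v \<in> Y \<or> u \<in> Y \<and> v \<in> X"
    unfolding bipartite_def by blast
  show "two_colorable (arcs_ends G)"
    by (rule two_colorableI[where c = "\<lambda>u. u \<in> X"]) (use XY in blast)
next
  assume "two_colorable (arcs_ends G)"
  then obtain c :: "'a \<Rightarrow> bool" where c: "\<forall>(u, v)\<in>arcs_ends G. c u \<noteq> c v"
    unfolding two_colorable_def by (rule exE)
  show "bipartite G"
    unfolding bipartite_def
  proof (intro exI conjI allI impI)
    show "{u \<in> verts G. c u} \<union> {u \<in> verts G. \<not> c u} = verts G" by blast
    show "{u \<in> verts G. c u} \<inter> {u \<in> verts G. \<not> c u} = {}" by blast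
    fix u v assume uv: "(u, v) \<in> arcs_ends G"
    then have "c u \<noteq> c v" using bspec[OF c uv] by simp
    moreover have "u \<in> verts G" "v \<in> verts G" using uv assms by blast+
    ultimately show "u \<in> {u \<in> verts G. c u} \<and> v \<in> {u \<in> verts G. \<not> c u} \<or>
        u \<in> {u \<in> verts G. \<not> c u} \<and> v \<in> {u \<in> verts G. c u}" by simp
  qed
qed

lemma (in pair_wf_digraph) bipartite_with_proj_iff:
  "bipartite (with_proj G) \<longleftrightarrow> two_colorable (parcs G)"
proof -
  have "parcs G \<subseteq> pverts G \<times> pverts G" using wellformed' by auto
  then show ?thesis using bipartite_iff_two_colorable[of "with_proj G"] by simp
qed

lemma reachable_imp_rtrancl: "x \<rightarrow>\<^sup>*\<^bsub>G\<^esub> y \<Longrightarrow> (x, y) \<in> (arcs_ends G)\<^sup>*"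
  unfolding reachable_def using rtrancl_on_sub_rtrancl by blast

text \<open>Connectedness is defined through the symmetric closure, which adds no arcs to a
  symmetric digraph.\<close>

lemma (in pair_sym_digraph) connected_imp_rtrancl:
  assumes "Digraph_Component.connected (with_proj G)" "u \<in> pverts G" "v \<in> pverts G"
  shows "(u, v) \<in> (parcs G)\<^sup>*"
proof -
  have "parcs (mk_symmetric (with_proj G)) \<subseteq> parcs G"
    using pair_sym_arcs unfolding mk_symmetric_def symmetric_def by (auto dest: symD)
  moreover have "u \<rightarrow>\<^sup>*\<^bsub>with_proj (mk_symmetric (with_proj G))\<^esub> v"
    using assms unfolding connected_def strongly_connected_def by (simp add: mk_symmetric_def)
  then have "(u, v) \<in> (parcs (mk_symmetric (with_proj G)))\<^sup>*"
    using reachable_imp_rtrancl by fastforce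
  ultimately show ?thesis using rtrancl_mono by blast
qed

section \<open>Injective renaming\<close>

lemma relpow_map_prod:
  assumes "(x, y) \<in> A ^^ n"
  shows "(f x, f y) \<in> (map_prod f f ` A) ^^ n"
  using assms
proof (induction n arbitrary: y)
  case (Suc n)
  then obtain z where "(x, z) \<in> A ^^ n" "(z, y) \<in> A" by auto
  with Suc.IH[of z] show ?case by (auto intro!: relcompI[of _ "f z"] image_eqI[of _ _ "(z, y)"])
qed simp

text \<open>A walk in the image is lifted edge by edge; injectivity makes the lifts of consecutive
  edges meet.\<close>

lemma relpow_map_prod_iff:
  assumes "A \<subseteq> V \<times> V" "inj_on f V" "x \<in> V" "y \<in> V"
  shows "(f x, f y) \<in> (map_prod f f ` A) ^^ n \<longleftrightarrow> (x, y) \<in> A ^^ n"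
proof
  \<comment> \<open>The end \<open>z\<close> is left free because the induction has to lift the
    intermediate vertices too.\<close>
  have "\<exists>y\<in>V. z = f y \<and> (x, y) \<in> A ^^ n" if "(f x, z) \<in> (map_prod f f ` A) ^^ n" for z
    using that
  proof (induction n arbitrary: z)
    case 0
    then show ?case using assms(3) by auto
  next
    case (Suc n)
    then obtain z' where z': "(f x, z') \<in> (map_prod f f ` A) ^^ n" "(z', z) \<in> map_prod f f ` A" by auto
    then obtain y' p q where y': "y' \<in> V" "z' = f y'" "(x, y') \<in> A ^^ n"
      and pq: "(p, q) \<in> A" "z' = f p" "z = f q" using Suc.IH[OF z'(1)] by auto
    then have "p = y'" "q \<in> V" using assms(1,2) by (auto dest: inj_onD)
    then show ?case using y' pq by (intro bexI[of _ q]) auto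
  qed
  moreover assume "(f x, f y) \<in> (map_prod f f ` A) ^^ n"
  ultimately obtain y' where "y' \<in> V" "f y = f y'" "(x, y') \<in> A ^^ n" by blast
  then show "(x, y) \<in> A ^^ n" using assms(2,4) by (auto dest: inj_onD)
qed (rule relpow_map_prod)

lemma resolves_map_prod:
  assumes A: "A \<subseteq> V \<times> V" and f: "inj_on f V" and B: "B \<subseteq> V" and res: "resolves B A"
  shows "resolves (f ` B) (map_prod f f ` A)"
proof -
  have d: "rel_dist (map_prod f f ` A) (f x) (f y) = rel_dist A x y" if "x \<in> V" "y \<in> V" for x y
    unfolding rel_dist_def relpow_map_prod_iff[OF A f that] ..
  have "\<exists>w\<in>f ` B. rel_dist (map_prod f f ` A) (f u) w \<noteq> rel_dist (map_prod f f ` A) (f v) w"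
    if uv: "(u, v) \<in> A" for u v
  proof -
    obtain w where w: "w \<in> B" "rel_dist A u w \<noteq> rel_dist A v w"
      using res uv unfolding resolves_def by blast
    moreover have "u \<in> V" "v \<in> V" "w \<in> V" using uv A w B by auto
    ultimately show ?thesis using d by (intro bexI[of _ "f w"]) auto
  qed
  then show ?thesis unfolding resolves_def by auto
qed

lemma two_colorable_map_prod_iff:
  assumes "A \<subseteq> V \<times> V" "inj_on f V"
  shows "two_colorable (map_prod f f ` A) \<longleftrightarrow> two_colorable A"
proof
  assume "two_colorable (map_prod f f ` A)"
  then obtain c :: "'b \<Rightarrow> bool" where c: "\<forall>(u, v)\<in>map_prod f f ` A. c u \<noteq> c v"
    unfolding two_colorable_def by (rule exE)
  show "two_colorable A"
  proof (rule two_colorableI[where c = "\<lambda>u. c (f u)"])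
    fix u v assume "(u, v) \<in> A"
    then have "(f u, f v) \<in> map_prod f f ` A" by (auto intro: image_eqI[of _ _ "(u, v)"])
    from bspec[OF c this] show "c (f u) \<noteq> c (f v)" by simp
  qed
next
  assume "two_colorable A"
  then obtain c :: "'a \<Rightarrow> bool" where c: "\<forall>(u, v)\<in>A. c u \<noteq> c v"
    unfolding two_colorable_def by (rule exE)
  show "two_colorable (map_prod f f ` A)"
  proof (rule two_colorableI[where c = "\<lambda>u. c (inv_into V f u)"])
    fix u' v' assume "(u', v') \<in> map_prod f f ` A"
    then obtain u v where uv: "(u, v) \<in> A" "u' = f u" "v' = f v" by auto
    moreover have "u \<in> V" "v \<in> V" using uv assms(1) by auto
    ultimately show "c (inv_into V f u') \<noteq> c (inv_into V f v')"
      using bspec[OF c uv(1)] inv_into_f_f[OF assms(2)] by simp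
  qed
qed

section \<open>Local metric bases\<close>

text \<open>An edge is distinguished by its own end \<open>u\<close>, at distance zero from itself
  and at positive distance from \<open>v\<close>. This guarantees that local metric bases
  exist.\<close>

lemma resolves_all_vertices:
  assumes "A \<subseteq> V \<times> V" "irrefl A" "\<And>u v. u \<in> V \<Longrightarrow> v \<in> V \<Longrightarrow> (u, v) \<in> A\<^sup>*"
  shows "resolves V A"
proof -
  have "\<exists>w\<in>V. rel_dist A u w \<noteq> rel_dist A v w" if uv: "(u, v) \<in> A" for u v
  proof (intro bexI)
    show u: "u \<in> V" using uv assms(1) by auto
    have "v \<in> V" using uv assms(1) by auto
    then have "(v, u) \<in> A ^^ rel_dist A v u" using assms(3) u by (blast intro: rel_dist_relpow)
    moreover have "u \<noteq> v" using uv assms(2) by (auto simp: irrefl_def)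
    ultimately have "rel_dist A v u \<noteq> 0" by (metis relpow_0_E)
    moreover have "rel_dist A u u = 0" using rel_dist_le[of u u 0 A] by simp
    ultimately show "rel_dist A u u \<noteq> rel_dist A v u" by simp
  qed
  then show ?thesis unfolding resolves_def by blast
qed

lemma local_metric_dim_le:
  "local_metric_generator G W \<Longrightarrow> local_metric_dim G \<le> card W"
  unfolding local_metric_dim_def by (rule Least_le) blast

lemma local_metric_basis_exists:
  assumes "local_metric_generator G W"
  shows "\<exists>B. local_metric_basis G B"
proof -
  have "\<exists>n W. local_metric_generator G W \<and> card W = n" using assms by blast
  then have "\<exists>W. local_metric_generator G W \<and> card W = local_metric_dim G"
    unfolding local_metric_dim_def by (rule LeastI_ex)
  then show ?thesis unfolding local_metric_basis_def .
qed

section \<open>The point-attaching construction\<close>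

locale attaching_sequence =
  fixes k :: nat and H :: "nat \<Rightarrow> 'a pair_pre_digraph" and a b :: "nat \<Rightarrow> 'a"
  assumes k_pos: "k \<ge> 1"
    and graph_H: "\<And>j. j < k \<Longrightarrow> pair_graph (H j)"
    and connected_H: "\<And>j. j < k \<Longrightarrow> Digraph_Component.connected (with_proj (H j))"
    and disjoint_H: "\<And>i j. i < k \<Longrightarrow> j < k \<Longrightarrow> i \<noteq> j \<Longrightarrow> pverts (H i) \<inter> pverts (H j) = {}"
    and a_in: "\<And>i. Suc i < k \<Longrightarrow> a i \<in> pverts (point_attach H a b i)"
    and b_in: "\<And>i. Suc i < k \<Longrightarrow> b i \<in> pverts (H (Suc i))"
begin

abbreviation P :: "nat \<Rightarrow> 'a pair_pre_digraph" where "P \<equiv> primary_subgraph H a b"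

abbreviation total :: "'a pair_pre_digraph" where "total \<equiv> point_attach H a b (k - 1)"

section \<open>Primary subgraphs as injectively renamed copies of the members\<close>

lemma pverts_point_attach: "pverts (point_attach H a b n) = (\<Union>l\<le>n. pverts (P l))"
  by (induction n) (auto simp: atMost_Suc)

lemma parcs_point_attach: "parcs (point_attach H a b n) = (\<Union>l\<le>n. parcs (P l))"
  by (induction n) (auto simp: atMost_Suc)

text \<open>The only vertex that renaming introduces, \<open>a n\<close>, is already an older
  one.\<close>

lemma pverts_point_attach_subset:
  "n < k \<Longrightarrow> pverts (point_attach H a b n) \<subseteq> (\<Union>l\<le>n. pverts (H l))"
proof (induction n)
  case (Suc n)
  then have IH: "pverts (point_attach H a b n) \<subseteq> (\<Union>l\<le>n. pverts (H l))" by simp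
  have "pverts (P (Suc n)) \<subseteq> insert (a n) (pverts (H (Suc n)))"
    by (auto simp: rename_vertex_def)
  then show ?case using IH a_in[OF Suc.prems] by (auto simp: atMost_Suc)
qed simp

text \<open>\<open>a i\<close> comes from an earlier member of the disjoint family. Hence renaming
  \<open>b i\<close> to \<open>a i\<close> is injective on \<open>H (Suc i)\<close>.\<close>

lemma a_notin: "Suc i < k \<Longrightarrow> a i \<notin> pverts (H (Suc i))"
proof
  assume i: "Suc i < k" and "a i \<in> pverts (H (Suc i))"
  moreover obtain l where "l \<le> i" "a i \<in> pverts (H l)"
    using pverts_point_attach_subset[of i] a_in[OF i] i by auto
  ultimately show False using disjoint_H[of l "Suc i"] by auto
qed

lemma primary_subgraph_image:
  assumes "j < k"
  shows "\<exists>f. inj_on f (pverts (H j)) \<and> pverts (P j) = f ` pverts (H j) \<and>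
    parcs (P j) = map_prod f f ` parcs (H j)"
proof (cases j)
  case 0
  then show ?thesis by (intro exI[of _ id]) (simp add: map_prod.id)
next
  case (Suc i)
  define f where "f = id(b i := a i)"
  have "inj_on f (pverts (H j))"
    using a_notin[of i] assms Suc unfolding f_def inj_on_def by auto
  then show ?thesis using Suc by (intro exI[of _ f]) (simp add: rename_vertex_def f_def)
qed

text \<open>Apart from \<open>a i\<close>, the vertices of the new subgraph belong to
  \<open>H (Suc i)\<close>, which is disjoint from everything older.\<close>

lemma glue_P:
  assumes i: "Suc i < k"
  shows "pverts (P (Suc i)) \<inter> (\<Union>l\<le>i. pverts (P l)) = {a i}"
proof
  have ai: "a i \<in> (\<Union>l\<le>i. pverts (P l))" using a_in[OF i] unfolding pverts_point_attach .
  have "a i \<in> pverts (P (Suc i))"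
    using b_in[OF i] by (auto simp: rename_vertex_def intro: rev_image_eqI)
  with ai show "{a i} \<subseteq> pverts (P (Suc i)) \<inter> (\<Union>l\<le>i. pverts (P l))" by blast
  have "(\<Union>l\<le>i. pverts (P l)) \<inter> pverts (H (Suc i)) = {}"
  proof -
    have "pverts (H l) \<inter> pverts (H (Suc i)) = {}" if "l \<le> i" for l
      using disjoint_H[of l "Suc i"] i that by simp
    moreover have "(\<Union>l\<le>i. pverts (P l)) \<subseteq> (\<Union>l\<le>i. pverts (H l))"
      using pverts_point_attach_subset[of i] i unfolding pverts_point_attach by simp
    ultimately show ?thesis by blast
  qed
  moreover have "pverts (P (Suc i)) \<subseteq> insert (a i) (pverts (H (Suc i)))"
    by (auto simp: rename_vertex_def)
  ultimately show "pverts (P (Suc i)) \<inter> (\<Union>l\<le>i. pverts (P l)) \<subseteq> {a i}" by blast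
qed

lemma H_facts:
  assumes "j < k"
  shows "finite (pverts (H j))" "pverts (H j) \<noteq> {}" "parcs (H j) \<subseteq> pverts (H j) \<times> pverts (H j)"
    "sym (parcs (H j))" "irrefl (parcs (H j))" "pair_wf_digraph (H j)"
    "\<And>u v. u \<in> pverts (H j) \<Longrightarrow> v \<in> pverts (H j) \<Longrightarrow> (u, v) \<in> (parcs (H j))\<^sup>*"
proof -
  interpret pair_graph "H j" using graph_H[OF assms] .
  show "finite (pverts (H j))" by (rule pair_finite_verts)
  show "pverts (H j) \<noteq> {}"
    using connected_H[OF assms] unfolding connected_def strongly_connected_def
    by (simp add: mk_symmetric_def)
  show "parcs (H j) \<subseteq> pverts (H j) \<times> pverts (H j)" using wellformed' by auto
  show "sym (parcs (H j))" using pair_sym_arcs unfolding symmetric_def by simp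
  show "irrefl (parcs (H j))" using no_loops' unfolding irrefl_def by blast
  show "pair_wf_digraph (H j)" by unfold_locales
  show "(u, v) \<in> (parcs (H j))\<^sup>*" if "u \<in> pverts (H j)" "v \<in> pverts (H j)" for u v
    using connected_imp_rtrancl[OF connected_H[OF assms] that] .
qed

lemma P_facts:
  assumes "j < k"
  shows "finite (pverts (P j))" "pverts (P j) \<noteq> {}" "parcs (P j) \<subseteq> pverts (P j) \<times> pverts (P j)"
    "sym (parcs (P j))" "irrefl (parcs (P j))" "pair_wf_digraph (P j)"
    "\<And>u v. u \<in> pverts (P j) \<Longrightarrow> v \<in> pverts (P j) \<Longrightarrow> (u, v) \<in> (parcs (P j))\<^sup>*"
    "two_colorable (parcs (P j)) \<longleftrightarrow> two_colorable (parcs (H j))"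
    "local_metric_dim (with_proj (P j)) \<le> local_metric_dim (with_proj (H j))"
proof -
  obtain f where f: "inj_on f (pverts (H j))" and PV: "pverts (P j) = f ` pverts (H j)"
    and PE: "parcs (P j) = map_prod f f ` parcs (H j)"
    using primary_subgraph_image[OF assms] by blast
  note H = H_facts[OF assms]
  show "finite (pverts (P j))" "pverts (P j) \<noteq> {}" using H PV by auto
  show sub: "parcs (P j) \<subseteq> pverts (P j) \<times> pverts (P j)" using H(3) PV PE by auto
  show "sym (parcs (P j))" unfolding PE sym_def using H(4)
    by (auto dest: symD intro: rev_image_eqI)
  show "irrefl (parcs (P j))" unfolding PE irrefl_def
  proof (intro allI notI)
    fix x assume "(x, x) \<in> map_prod f f ` parcs (H j)"
    then obtain u v where uv: "(u, v) \<in> parcs (H j)" "f u = f v" by auto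
    then have "u = v" using f H(3) by (auto dest: inj_onD)
    then show False using uv H(5) by (simp add: irrefl_def)
  qed
  show wf: "pair_wf_digraph (P j)" using sub by unfold_locales auto
  show "(u, v) \<in> (parcs (P j))\<^sup>*" if "u \<in> pverts (P j)" "v \<in> pverts (P j)" for u v
  proof -
    obtain x y where xy: "x \<in> pverts (H j)" "y \<in> pverts (H j)" "u = f x" "v = f y"
      using \<open>u \<in> pverts (P j)\<close> \<open>v \<in> pverts (P j)\<close> PV by auto
    then have "(x, y) \<in> (parcs (H j))\<^sup>*" using H(7) by simp
    then obtain n where "(x, y) \<in> parcs (H j) ^^ n" using rtrancl_imp_relpow by blast
    from relpow_map_prod[OF this, of f] show ?thesis
      unfolding xy PE by (rule relpow_imp_rtrancl)
  qed
  show "two_colorable (parcs (P j)) \<longleftrightarrow> two_colorable (parcs (H j))"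
    unfolding PE by (rule two_colorable_map_prod_iff[OF H(3) f])
  \<comment> \<open>For the dimension, a basis of \<open>H j\<close> is carried by \<open>f\<close>
    to a generator of \<open>P j\<close> of the same size.\<close>
  have "local_metric_generator (with_proj (H j)) (pverts (H j))"
    unfolding pair_wf_digraph.local_metric_generator_iff[OF H(6)]
    using resolves_all_vertices[OF H(3,5,7)] by simp
  then obtain B where B: "local_metric_basis (with_proj (H j)) B"
    using local_metric_basis_exists by blast
  then have "B \<subseteq> pverts (H j)" "resolves B (parcs (H j))"
    unfolding local_metric_basis_def pair_wf_digraph.local_metric_generator_iff[OF H(6)] by auto
  then have "local_metric_generator (with_proj (P j)) (f ` B)" and inj: "inj_on f B"
    unfolding pair_wf_digraph.local_metric_generator_iff[OF wf] PV PE
    using resolves_map_prod[OF H(3) f] inj_on_subset[OF f] by auto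
  then have "local_metric_dim (with_proj (P j)) \<le> card (f ` B)" by (intro local_metric_dim_le)
  also have "\<dots> = local_metric_dim (with_proj (H j))"
    using B card_image[OF inj] unfolding local_metric_basis_def by simp
  finally show "local_metric_dim (with_proj (P j)) \<le> local_metric_dim (with_proj (H j))" .
qed

sublocale point_attached k "\<lambda>j. pverts (P j)" "\<lambda>j. parcs (P j)" a
  using P_facts(1-4,7) glue_P by unfold_locales auto

section \<open>The whole graph, its attached parts and the final count\<close>

lemma less_k_eq: "{..<k} = {..k - 1}"
  using k_pos by auto

lemma pverts_total: "pverts total = verts_all"
  unfolding pverts_point_attach verts_all_def less_k_eq ..

lemma parcs_total: "parcs total = edges_all"
  unfolding parcs_point_attach edges_all_def less_k_eq ..

lemma wf_total: "pair_wf_digraph total"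
proof -
  have "u \<in> verts_all \<and> v \<in> verts_all" if "(u, v) \<in> edges_all" for u v
    using that by (elim edges_allE) (auto simp: verts_all_def)
  then show ?thesis unfolding pair_wf_digraph_def pverts_total parcs_total by auto
qed

text \<open>The edges of the attached part are contained in \<open>part_edges\<close>, and a
  two-colouring of the larger relation would restrict to the smaller.\<close>

lemma attached_part_not_bipartite:
  assumes "\<not> bipartite (attached_part k H a b j x)"
  shows "\<not> two_colorable (part_edges j x)"
proof -
  define D where "D = edges_all - ({x} \<times> pverts (P j) \<union> pverts (P j) \<times> {x})"
  define R where "R = with_proj (remove_edges_to total x (pverts (P j)))"
  have RD: "arcs_ends R = D"
    unfolding R_def D_def remove_edges_to_def with_proj_simps parcs_total[symmetric] by simp
  have part: "attached_part k H a b j x = R \<restriction> {y. x \<rightarrow>\<^sup>*\<^bsub>R\<^esub> y}"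
    unfolding attached_part_def component_of_def R_def ..
  have "arcs_ends (attached_part k H a b j x) \<subseteq>
      verts (attached_part k H a b j x) \<times> verts (attached_part k H a b j x)"
    unfolding part by (auto simp: arcs_ends_conv)
  then have "\<not> two_colorable (arcs_ends (attached_part k H a b j x))"
    using assms bipartite_iff_two_colorable by blast
  moreover have "arcs_ends (attached_part k H a b j x) \<subseteq> part_edges j x"
  proof (rule subrelI)
    fix u v assume "(u, v) \<in> arcs_ends (attached_part k H a b j x)"
    then have "(u, v) \<in> D" "x \<rightarrow>\<^sup>*\<^bsub>R\<^esub> u" "x \<rightarrow>\<^sup>*\<^bsub>R\<^esub> v"
      unfolding part RD[symmetric] by (auto simp: arcs_ends_conv)
    moreover from this have "(x, u) \<in> D\<^sup>*" "(x, v) \<in> D\<^sup>*"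
      using reachable_imp_rtrancl RD by metis+
    ultimately show "(u, v) \<in> part_edges j x"
      unfolding part_edges_def Let_def D_def by simp
  qed
  ultimately show ?thesis using two_colorable_mono by metis
qed

text \<open>The maximum is over a nonempty set, as bases exist, that is bounded by the number of
  vertices of \<open>P j\<close>.\<close>

lemma attachment_number_attained:
  assumes "j < k"
  shows "\<exists>B. local_metric_basis (with_proj (P j)) B \<and>
    attachment_number k H a b j = card (nonbipartite_attachments k H a b j \<inter> B)"
proof -
  note P = P_facts[OF assms]
  let ?S = "{card (nonbipartite_attachments k H a b j \<inter> B) | B.
    local_metric_basis (with_proj (P j)) B}"
  have "local_metric_generator (with_proj (P j)) (pverts (P j))"
    unfolding pair_wf_digraph.local_metric_generator_iff[OF P(6)]
    using resolves_all_vertices[OF P(3,5,7)] by simp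
  then have "?S \<noteq> {}" using local_metric_basis_exists by blast
  moreover have "?S \<subseteq> {..card (pverts (P j))}"
  proof
    fix n assume "n \<in> ?S"
    then obtain B where "n = card (nonbipartite_attachments k H a b j \<inter> B)" "B \<subseteq> pverts (P j)"
      unfolding local_metric_basis_def local_metric_generator_def by auto
    then show "n \<in> {..card (pverts (P j))}" using card_mono[OF P(1)] by blast
  qed
  then have "finite ?S" using finite_subset by blast
  ultimately have "Max ?S \<in> ?S" by (intro Max_in)
  then show ?thesis unfolding attachment_number_def by blast
qed

text \<open>Counts the generator \<open>W\<close>, whose share from G_j is a basis without its
  \<alpha>_j elements in \<open>C j\<close>. Differences are taken in the integers, so nothing is
  truncated.\<close>

lemma local_metric_dim_point_attach_le:
  assumes "\<not> bipartite (with_proj total)"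
  shows "int (local_metric_dim (with_proj total))
    \<le> (\<Sum>j\<in>nonbipartite_indices k H.
         int (local_metric_dim (with_proj (H j))) - int (attachment_number k H a b j))"
proof -
  define C where "C = nonbipartite_attachments k H a b"
  have "\<forall>j. \<exists>B. j < k \<longrightarrow> local_metric_basis (with_proj (P j)) B \<and>
      attachment_number k H a b j = card (C j \<inter> B)"
    using attachment_number_attained unfolding C_def by blast
  then obtain B where B: "\<And>j. j < k \<Longrightarrow> local_metric_basis (with_proj (P j)) (B j)"
      "\<And>j. j < k \<Longrightarrow> attachment_number k H a b j = card (C j \<inter> B j)"
    by metis
  have Bres: "B j \<subseteq> pverts (P j) \<and> resolves (B j) (parcs (P j))" if "j < k" for j
    using B(1)[OF that] pair_wf_digraph.local_metric_generator_iff[OF P_facts(6)[OF that]]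
    unfolding local_metric_basis_def by simp
  have Cnb: "x \<in> pverts (P j) \<and> \<not> two_colorable (part_edges j x)" if "j < k" "x \<in> C j" for j x
    using that attached_part_not_bipartite unfolding C_def nonbipartite_attachments_def by simp
  let ?J = "nonbipartite_indices k H"
  \<comment> \<open>The index set refers to the members \<open>H j\<close>, the generator to their
    copies \<open>P j\<close>; renaming preserves two-colourability.\<close>
  have J: "?J = {j. j < k \<and> \<not> two_colorable (parcs (P j))}"
    unfolding nonbipartite_indices_def
    using P_facts(8) pair_wf_digraph.bipartite_with_proj_iff[OF H_facts(6)] by auto
  have Jk: "j < k" if "j \<in> ?J" for j using that unfolding J by simp
  have "finite ?J" unfolding J by simp
  define W where "W = (\<Union>j\<in>?J. B j - C j)"
  have "\<not> two_colorable edges_all"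
    using assms pair_wf_digraph.bipartite_with_proj_iff[OF wf_total] parcs_total by simp
  from resolves_point_attached[where C = C and B = B, OF Cnb Bres this]
  have "resolves W edges_all" unfolding W_def J .
  moreover have "W \<subseteq> verts_all" unfolding W_def J verts_all_def using Bres by blast
  ultimately have "local_metric_generator (with_proj total) W"
    unfolding pair_wf_digraph.local_metric_generator_iff[OF wf_total] pverts_total parcs_total by simp
  then have "local_metric_dim (with_proj total) \<le> card W" by (rule local_metric_dim_le)
  also have "\<dots> \<le> (\<Sum>j\<in>?J. card (B j - C j))"
    unfolding W_def using \<open>finite ?J\<close> by (rule card_UN_le)
  finally have "int (local_metric_dim (with_proj total)) \<le> (\<Sum>j\<in>?J. int (card (B j - C j)))"
    by (metis of_nat_le_iff of_nat_sum)
  also have "\<dots> \<le> (\<Sum>j\<in>?J.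
      int (local_metric_dim (with_proj (H j))) - int (attachment_number k H a b j))"
  proof (rule sum_mono)
    fix j assume "j \<in> ?J"
    then have j: "j < k" by (rule Jk)
    have "finite (B j)" using Bres[OF j] P_facts(1)[OF j] finite_subset by blast
    \<comment> \<open>The first summand is the number \<alpha>_j, by the choice of
      \<open>B j\<close>.\<close>
    then have "card (B j) = card (C j \<inter> B j) + card (B j - C j)"
      by (metis Int_commute card_Int_Diff)
    moreover have "card (B j) \<le> local_metric_dim (with_proj (H j))"
      using B(1)[OF j] P_facts(9)[OF j] unfolding local_metric_basis_def by simp
    ultimately show "int (card (B j - C j)) \<le>
        int (local_metric_dim (with_proj (H j))) - int (attachment_number k H a b j)"
      using B(2)[OF j] by simp
  qed
  finally show ?thesis .
qed

end

theorem theorem3: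
  fixes k :: nat
    and H :: "nat \<Rightarrow> 'a pair_pre_digraph"
    and a b :: "nat \<Rightarrow> 'a"
  assumes "k \<ge> 1"
    and "\<And>j. j < k \<Longrightarrow> pair_graph (H j)"
    and "\<And>j. j < k \<Longrightarrow> Digraph_Component.connected (with_proj (H j))"
    and "\<And>j. j < k \<Longrightarrow> card (pverts (H j)) \<ge> 2"
    and "\<And>i j. i < k \<Longrightarrow> j < k \<Longrightarrow> i \<noteq> j \<Longrightarrow> pverts (H i) \<inter> pverts (H j) = {}"
    and "\<And>i. Suc i < k \<Longrightarrow> a i \<in> pverts (point_attach H a b i)"
    and "\<And>i. Suc i < k \<Longrightarrow> b i \<in> pverts (H (Suc i))"
    and "\<not> bipartite (with_proj (point_attach H a b (k - 1)))"
  shows "int (local_metric_dim (with_proj (point_attach H a b (k - 1))))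
    \<le> (\<Sum>j\<in>nonbipartite_indices k H.
         int (local_metric_dim (with_proj (H j))) - int (attachment_number k H a b j))"
proof -
  interpret attaching_sequence k H a b
    using assms(1-3,5-7) by (simp add: attaching_sequence_def)
  show ?thesis using assms(8) by (rule local_metric_dim_point_attach_le)
qed

end
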